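(* Let $q$ be a power of a prime $p$, let $f\in \mathbb{F}_q[X]$ be a nonconstant polynomial not divisible by $X$, let $f_0$ be its squarefree part and let $e$ be the least positive integer such that $f(X)$ divides $f_0(X)^e$. If $E=\mathrm{ord}(f_0)$, then for $A=L_f(X)$ and every $n\ge 1$, we have $$s_A(n)=E\cdot p^{\lceil \log_p (ne)\rceil }.$$ In particular, if $c_A>0$ is the real number such that the set of limit points of the sequence $\left\{\frac{s_A(n)}{n}\right\}_{n\ge 1}$ equals $[c_A,pc_A]$, then $c_A=Ee$.
   Context: $\mathbb{F}_q$ denotes the finite field with $q$ elements. For $f(X)=\sum_{i=0}^r a_iX^i\in\mathbb{F}_q[X]$, its $q$-linearized associate is $L_f(X)=\sum_{i=0}^r a_iX^{q^i}$. The squarefree part of $f$ is the product of its distinct monic irreducible factors over $\mathbb{F}_q$. For $g\in\mathbb{F}_q[X]$ not divisible by $X$, $\mathrm{ord}(g)$ is the smallest positive integer $i$ such that $g(X)$ divides $X^i-1$. For a polynomial $F$ and $n\ge 1$, $F^{(n)}(X)$ denotes the $n$-fold composition of $F$ with itself, and for nonconstant $F\in\mathbb{F}_q[X]$, $s_F(n)$ is the smallest positive integer $s$ such that $F^{(n)}(X)$ splits completely over $\mathbb{F}_{q^{s}}$. For every additive polynomial $A\in\mathbb{F}_q[X]$ (i.e. $A(X+Y)=A(X)+A(Y)$) not of the form $aX^{p^h}$, a constant $c_A>0$ as in the claim exists. *)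

theory Defs
  imports Complex_Main "HOL-Library.Cardinality" "HOL-Algebra.Algebraic_Closure_Type"
begin

text \<open>
  The field with \<open>q\<close> elements is a type \<open>'a :: finite_field\<close> with \<open>q = CARD('a)\<close>.
\<close>

definition linearized_associate :: "'a :: finite_field poly \<Rightarrow> 'a poly" where
  "linearized_associate f =
     (\<Sum>i\<le>Polynomial.degree f. Polynomial.monom (Polynomial.coeff f i) (CARD('a) ^ i))"

text \<open>
  The product of the distinct monic irreducible factors. This is not \<open>squarefree_part\<close> from
  \<open>HOL-Computational_Algebra.Squarefree\<close>, which divides out the largest square factor.
\<close>

definition poly_squarefree_part :: "'a :: field poly \<Rightarrow> 'a poly" where
  "poly_squarefree_part f = \<Prod>{g. irreducible g \<and> Polynomial.lead_coeff g = 1 \<and> g dvd f}"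

text \<open>Only meaningful for \<open>g\<close> over a finite field and not divisible by \<open>X\<close>.\<close>

definition poly_ord :: "'a :: field poly \<Rightarrow> nat" where
  "poly_ord g = (LEAST i. 0 < i \<and> g dvd Polynomial.monom 1 i - 1)"

definition poly_iterate :: "'a :: comm_semiring_1 poly \<Rightarrow> nat \<Rightarrow> 'a poly" where
  "poly_iterate F n = (pcompose F ^^ n) [:0, 1:]"

text \<open>
  The field with \<open>q ^ s\<close> elements is realised as the (unique) subfield of that cardinality
  of the algebraic closure; it contains the image of \<open>'a\<close> under \<open>to_ac\<close>.
\<close>

definition splits_over :: "'a :: field alg_closure set \<Rightarrow> 'a poly \<Rightarrow> bool" where
  "splits_over K F \<longleftrightarrow>
     (\<exists>xs. set xs \<subseteq> K \<and>
        map_poly to_ac F = smult (to_ac (Polynomial.lead_coeff F)) (\<Prod>x\<leftarrow>xs. [:- x, 1:]))"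

definition splits_over_degree :: "nat \<Rightarrow> 'a :: finite_field poly \<Rightarrow> bool" where
  "splits_over_degree s F \<longleftrightarrow>
     (\<exists>K. subfield K (ring_of_type_algebra :: 'a alg_closure ring) \<and>
          card K = CARD('a) ^ s \<and> splits_over K F)"

definition split_degree :: "'a :: finite_field poly \<Rightarrow> nat \<Rightarrow> nat" where
  "split_degree F n = (LEAST s. 0 < s \<and> splits_over_degree s (poly_iterate F n))"

text \<open>
  Limit points of a sequence in the sense of subsequential limits (not accumulation points
  of its range).
\<close>

definition seq_limit_points :: "(nat \<Rightarrow> real) \<Rightarrow> real set" where
  "seq_limit_points a = {l. \<exists>r. strict_mono r \<and> (a \<circ> r) \<longlonglongrightarrow> l}"

end

theory Submission
  imports Defs
begin

text \<open>
  The map \<open>f \<mapsto> L\<^sub>f\<close> turns products into compositions, so the \<open>n\<close>-th iterate of \<open>L\<^sub>f\<close> is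
  \<open>L\<^sub>g\<close> with \<open>g = f ^ n\<close>. The elements of the field with \<open>q ^ s\<close> elements are the roots of
  \<open>X ^ (q ^ s) - X\<close>, the associate of \<open>X ^ s - 1\<close>, and \<open>L\<^sub>g\<close> is separable as \<open>g(0) \<noteq> 0\<close>;
  hence \<open>L\<^sub>g\<close> splits over that field iff \<open>g\<close> divides \<open>X ^ s - 1\<close>. Writing \<open>s = m p ^ v\<close> with
  \<open>p\<close> not dividing \<open>m\<close>, we have \<open>X ^ s - 1 = (X ^ m - 1) ^ (p ^ v)\<close> with \<open>X ^ m - 1\<close>
  squarefree, so \<open>f ^ n\<close> divides it iff \<open>f\<^sub>0\<close> divides \<open>X ^ m - 1\<close> and \<open>n e \<le> p ^ v\<close>.
  Finally \<open>E e\<close> is the least limit point of the quotients, attained along \<open>n = p ^ k div e\<close>.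
\<close>

section \<open>Evaluation of linearized associates\<close>

text \<open>The value of the associate of \<open>f\<close> at \<open>x\<close>, with coefficients
  transported by \<open>h\<close>. Two instances matter: constants \<open>[:a:]\<close> in the
  polynomial ring, where evaluation is composition, and \<open>to_ac\<close>, where zeros are the
  roots in the closure.\<close>

definition lin_eval :: "('a :: finite_field \<Rightarrow> 'b :: comm_ring_1) \<Rightarrow> 'a poly \<Rightarrow> 'b \<Rightarrow> 'b" where
  "lin_eval h f x = (\<Sum>i\<le>Polynomial.degree f. h (Polynomial.coeff f i) * x ^ (CARD('a) ^ i))"

locale frobenius_hom =
  fixes h :: "'a :: finite_field \<Rightarrow> 'b :: comm_ring_1"
  assumes hom_0: "h 0 = 0"
    and hom_1: "h 1 = 1"
    and hom_add: "h (a + b) = h a + h b"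
    and hom_mult: "h (a * b) = h a * h b"
    and frobenius_add: "(x + y :: 'b) ^ CARD('a) = x ^ CARD('a) + y ^ CARD('a)"
begin

lemma lin_eval_altdef:
  assumes "Polynomial.degree f \<le> n"
  shows "lin_eval h f x = (\<Sum>i\<le>n. h (Polynomial.coeff f i) * x ^ (CARD('a) ^ i))"
  unfolding lin_eval_def
  by (rule sum.mono_neutral_left) (use assms in \<open>auto simp: coeff_eq_0 hom_0\<close>)

lemma lin_eval_0: "lin_eval h 0 x = 0"
  by (simp add: lin_eval_def hom_0)

lemma lin_eval_pCons: "lin_eval h (pCons a f) x = h a * x + lin_eval h f (x ^ CARD('a))"
proof -
  have "lin_eval h (pCons a f) x =
      (\<Sum>i\<le>Suc (Polynomial.degree f). h (Polynomial.coeff (pCons a f) i) * x ^ (CARD('a) ^ i))"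
    by (rule lin_eval_altdef) (rule degree_pCons_le)
  also have "\<dots> = h a * x + (\<Sum>i\<le>Polynomial.degree f.
      h (Polynomial.coeff f i) * x ^ (CARD('a) ^ Suc i))"
    by (subst sum.atMost_Suc_shift) simp
  finally show ?thesis
    by (simp add: lin_eval_def power_mult)
qed

lemma lin_eval_add: "lin_eval h (f + g) x = lin_eval h f x + lin_eval h g x"
proof -
  define n where "n = max (Polynomial.degree f) (Polynomial.degree g)"
  have "Polynomial.degree (f + g) \<le> n"
    unfolding n_def by (rule degree_add_le_max)
  then show ?thesis
    by (simp add: lin_eval_altdef[of _ n] n_def sum.distrib[symmetric] hom_add algebra_simps)
qed

lemma lin_eval_diff: "lin_eval h (f - g) x = lin_eval h f x - lin_eval h g x"
  using lin_eval_add[of "f - g" g] by (simp add: algebra_simps)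

lemma lin_eval_smult: "lin_eval h (Polynomial.smult c f) x = h c * lin_eval h f x"
  by (simp add: lin_eval_altdef[OF degree_smult_le] lin_eval_def sum_distrib_left hom_0 hom_mult mult_ac)

lemma lin_eval_1: "lin_eval h 1 x = x"
  by (simp add: lin_eval_def hom_1)

text \<open>The coefficients satisfy a^q = a, so raising to the power q passes through each
  term.\<close>

lemma lin_eval_frobenius: "lin_eval h f (x ^ CARD('a)) = lin_eval h f x ^ CARD('a)"
proof (induction f arbitrary: x)
  case 0
  then show ?case by (simp add: lin_eval_0 power_0_left)
next
  case (pCons a f)
  have "h a ^ n = h (a ^ n)" for n
    by (induction n) (simp_all add: hom_1 hom_mult)
  then have "h a ^ CARD('a) = h a"
    by (simp add: finite_field_power_card_eq_same)
  then show ?case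
    by (simp add: lin_eval_pCons pCons.IH frobenius_add power_mult_distrib)
qed

text \<open>By induction on \<open>f\<close>: multiplication by X corresponds to applying the
  q-Frobenius, which commutes with the inner evaluation by
  \<open>lin_eval_frobenius\<close>.\<close>

lemma lin_eval_mult: "lin_eval h (f * g) x = lin_eval h f (lin_eval h g x)"
proof (induction f arbitrary: x)
  case 0
  then show ?case by (simp add: lin_eval_0)
next
  case (pCons a f)
  then show ?case
    by (simp add: lin_eval_pCons lin_eval_add lin_eval_smult hom_0 lin_eval_frobenius)
qed

lemma lin_eval_zero_right: "lin_eval h f 0 = 0"
  by (simp add: lin_eval_def power_0_left)

lemma lin_eval_monom: "lin_eval h (Polynomial.monom 1 n) x = x ^ (CARD('a) ^ n)"
proof (induction n arbitrary: x)
  case 0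
  then show ?case by (simp add: lin_eval_1 flip: one_pCons)
next
  case (Suc n)
  then show ?case
    by (simp add: monom_Suc lin_eval_pCons hom_0 power_mult)
qed

end

lemma frobenius_homI:
  fixes h :: "'a :: finite_field \<Rightarrow> 'b :: comm_ring_1"
  assumes "CHAR('b) = CHAR('a)" "CARD('a) = CHAR('a) ^ k"
    and "h 0 = 0" "h 1 = 1" "\<And>a b. h (a + b) = h a + h b" "\<And>a b. h (a * b) = h a * h b"
  shows "frobenius_hom h"
proof
  show "(x + y) ^ CARD('a) = x ^ CARD('a) + y ^ CARD('a)" for x y :: 'b
    by (rule freshmans_dream'[where n = k]) (simp_all add: assms)
qed (use assms in auto)

lemma pcompose_linearized_associate:
  "pcompose (linearized_associate f) P = lin_eval (\<lambda>a. [:a:]) f P"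
  unfolding linearized_associate_def lin_eval_def
  by (simp add: pcompose_sum, simp add: pcompose_altdef map_poly_monom poly_monom)

lemma linearized_associate_eq_lin_eval:
  "linearized_associate f = lin_eval (\<lambda>a. [:a:]) f [:0, 1:]"
  by (metis pcompose_idR pcompose_linearized_associate)

lemma poly_iterate_linearized_associate:
  fixes f :: "'a :: finite_field poly"
  assumes "CARD('a) = CHAR('a) ^ k"
  shows "poly_iterate (linearized_associate f) n = linearized_associate (f ^ n)"
proof -
  interpret frobenius_hom "\<lambda>a :: 'a. [:a:]"
    by (rule frobenius_homI[OF _ assms]) (simp_all add: one_pCons)
  show ?thesis
  proof (induction n)
    case 0
    then show ?case by (simp add: poly_iterate_def linearized_associate_eq_lin_eval lin_eval_1)
  next
    case (Suc n)
    have "poly_iterate (linearized_associate f) (Suc n) =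
        pcompose (linearized_associate f) (linearized_associate (f ^ n))"
      using Suc by (simp add: poly_iterate_def)
    then show ?case
      by (simp add: pcompose_linearized_associate lin_eval_mult
          linearized_associate_eq_lin_eval[of "f ^ n"] linearized_associate_eq_lin_eval[of "f * f ^ n"])
  qed
qed

lemma poly_linearized_associate:
  "poly (map_poly to_ac (linearized_associate f)) x = lin_eval to_ac f x"
proof -
  have "map_poly to_ac (\<Sum>i\<in>I. Polynomial.monom (c i) (d i)) =
     (\<Sum>i\<in>I. Polynomial.monom (to_ac (c i)) (d i))" if "finite I" 
    for I :: "nat set" and c :: "nat \<Rightarrow> 'a" and d :: "nat \<Rightarrow> nat"
    using that by (intro poly_eqI) (auto simp: coeff_map_poly coeff_sum to_ac_sum intro!: sum.cong)
  then show ?thesis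
    by (simp add: linearized_associate_def lin_eval_def poly_sum poly_monom)
qed

section \<open>Roots in the algebraic closure\<close>

lemma map_poly_to_ac_linearized_associate:
  "map_poly to_ac (linearized_associate f) =
    (\<Sum>i\<le>Polynomial.degree f. Polynomial.monom (to_ac (Polynomial.coeff f i)) (CARD('a) ^ i))"
  for f :: "'a :: finite_field poly"
  by (intro poly_eqI)
    (auto simp: linearized_associate_def coeff_map_poly coeff_sum to_ac_sum intro!: sum.cong)

lemma CARD_field_gt_1: "CARD('a :: finite_field) > 1"
proof -
  have "card {0, 1 :: 'a} \<le> CARD('a)"
    by (rule card_mono) auto
  then show ?thesis by simp
qed

lemma linearized_associate_degree_and_nonzero:
  fixes f :: "'a :: finite_field poly"
  assumes "f \<noteq> 0"
  shows "Polynomial.degree (linearized_associate f) = CARD('a) ^ Polynomial.degree f"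
    and "linearized_associate f \<noteq> 0"
proof -
  \<comment> \<open>As q > 1, the exponents q^i are distinct, so only the top term contributes
    here.\<close>
  have "Polynomial.coeff (linearized_associate f) (CARD('a) ^ Polynomial.degree f) =
      (\<Sum>i\<le>Polynomial.degree f. if i = Polynomial.degree f then Polynomial.coeff f i else 0)"
    using CARD_field_gt_1[where 'a = 'a]
    unfolding linearized_associate_def coeff_sum by (intro sum.cong) auto
  then have nz: "Polynomial.coeff (linearized_associate f) (CARD('a) ^ Polynomial.degree f) \<noteq> 0"
    using assms by simp
  then show "linearized_associate f \<noteq> 0"
    by auto
  have "Polynomial.degree (linearized_associate f) \<le> CARD('a) ^ Polynomial.degree f"
    unfolding linearized_associate_def
    using CARD_field_gt_1[where 'a = 'a]
    by (intro degree_sum_le) (auto intro!: order.trans[OF degree_monom_le] power_increasing)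
  with nz show "Polynomial.degree (linearized_associate f) = CARD('a) ^ Polynomial.degree f"
    by (simp add: le_degree order_antisym)
qed

text \<open>P is a product of linear factors indexed by a multiset; an element occurring twice would
  be a common root of P and its derivative.\<close>

lemma card_roots_separable:
  fixes P :: "'a :: alg_closed_field poly"
  assumes "P \<noteq> 0" and sep: "\<And>x. poly P x = 0 \<Longrightarrow> poly (pderiv P) x \<noteq> 0"
  shows "card {x. poly P x = 0} = Polynomial.degree P"
proof -
  obtain A where A: "size A = Polynomial.degree P"
      "P = Polynomial.smult (Polynomial.lead_coeff P) (\<Prod>x\<in>#A. [:-x, 1:])"
    using alg_closed_imp_factorization[OF assms(1)] by blast
  define c where "c = Polynomial.lead_coeff P"
  have c: "c \<noteq> 0" "P = Polynomial.smult c (\<Prod>x\<in>#A. [:-x, 1:])"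
    using assms(1) A(2) by (auto simp: c_def)
  have roots: "{x. poly P x = 0} = set_mset A"
    by (subst c(2)) (auto simp: c(1) poly_prod_mset prod_mset_zero_iff)
  have "count A x = 1" if "x \<in># A" for x
  proof (rule ccontr)
    assume "count A x \<noteq> 1"
    with that have "count A x \<ge> 2"
      by (metis One_nat_def Suc_1 Suc_leI count_greater_zero_iff le_neq_implies_less)
    then have "{#x, x#} \<subseteq># A"
      by (auto simp: subseteq_mset_def)
    then obtain B where "A = {#x, x#} + B"
      by (meson mset_subset_eq_exists_conv)
    then have "P = [:-x, 1:] * ([:-x, 1:] * Polynomial.smult c (\<Prod>x\<in>#B. [:-x, 1:]))"
      by (subst c(2)) (simp add: algebra_simps)
    then have "poly P x = 0" "poly (pderiv P) x = 0"
      by (simp_all only: pderiv_mult poly_mult poly_add) simp_all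
    with sep show False by blast
  qed
  then have "size A = card (set_mset A)"
    by (simp add: size_multiset_overloaded_eq)
  with A(1) roots show ?thesis by simp
qed

text \<open>Translation by 1 permutes the ring, so the sum of all elements is unchanged when 1 is
  added to each of them.\<close>

lemma of_nat_CARD_eq_0: "of_nat CARD('a) = (0 :: 'a :: {ring_1, finite})"
proof -
  have "(\<Sum>x\<in>(UNIV :: 'a set). x + 1) = (\<Sum>x\<in>UNIV. x)"
    by (rule sum.reindex_bij_witness[of _ "\<lambda>x. x - 1" "\<lambda>x. x + 1"]) auto
  then show ?thesis
    by (simp add: sum.distrib)
qed

text \<open>The derivative of the associate is the constant \<open>coeff g 0\<close>, since q^i
  vanishes in the field for i > 0. So there are no multiple roots, and the number of roots is the
  degree.\<close>

lemma card_roots_lin_eval: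
  fixes g :: "'a :: finite_field poly"
  assumes "Polynomial.coeff g 0 \<noteq> 0"
  shows "card {x. lin_eval to_ac g x = 0} = CARD('a) ^ Polynomial.degree g"
proof -
  define P where "P = map_poly to_ac (linearized_associate g)"
  have [simp]: "g \<noteq> 0"
    using assms by auto
  have "of_nat (CARD('a)) = (0 :: 'a alg_closure)"
    using of_nat_CARD_eq_0[where 'a = 'a] by (metis to_ac_0 to_ac_of_nat)
  then have q0: "of_nat (CARD('a) ^ i) = (if i = 0 then 1 else 0 :: 'a alg_closure)" for i
    by (simp add: power_0_left)
  have "pderiv P = (\<Sum>i\<le>Polynomial.degree g.
      Polynomial.monom (of_nat (CARD('a) ^ i) * to_ac (Polynomial.coeff g i)) (CARD('a) ^ i - 1))"
    unfolding P_def map_poly_to_ac_linearized_associate higher_pderiv_sum[of 1, simplified]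
      pderiv_monom ..
  also have "\<dots> = (\<Sum>i\<le>Polynomial.degree g. if i = 0 then [:to_ac (Polynomial.coeff g 0):] else 0)"
    by (intro sum.cong) (auto simp: q0 monom_0 simp del: of_nat_power)
  finally have pderiv: "pderiv P = [:to_ac (Polynomial.coeff g 0):]"
    by simp
  have deg: "Polynomial.degree P = CARD('a) ^ Polynomial.degree g"
    unfolding P_def by (subst degree_map_poly) (simp_all add: linearized_associate_degree_and_nonzero)
  then have "P \<noteq> 0"
    by auto
  then have "card {x. poly P x = 0} = Polynomial.degree P"
    by (rule card_roots_separable) (simp add: pderiv assms)
  then show ?thesis
    by (simp add: P_def poly_linearized_associate deg[unfolded P_def])
qed

lemma poly_prod_linear_factors_eq_0_iff:
  fixes xs :: "'a :: idom list"
  shows "poly (\<Prod>x\<leftarrow>xs. [:- x, 1:]) z = 0 \<longleftrightarrow> z \<in> set xs"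
  by (induction xs) auto

lemma splits_over_iff:
  fixes F :: "'a :: field poly"
  assumes "F \<noteq> 0"
  shows "splits_over K F \<longleftrightarrow> {x. poly (map_poly to_ac F) x = 0} \<subseteq> K"
proof
  assume "splits_over K F"
  then obtain xs where xs: "set xs \<subseteq> K"
      "map_poly to_ac F = Polynomial.smult (to_ac (Polynomial.lead_coeff F)) (\<Prod>x\<leftarrow>xs. [:- x, 1:])"
    unfolding splits_over_def by blast
  have "x \<in> set xs" if "poly (map_poly to_ac F) x = 0" for x
    using that assms unfolding xs(2) by (auto simp: poly_prod_linear_factors_eq_0_iff)
  with xs(1) show "{x. poly (map_poly to_ac F) x = 0} \<subseteq> K"
    by blast
next
  assume sub: "{x. poly (map_poly to_ac F) x = 0} \<subseteq> K"
  define P where "P = map_poly to_ac F"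
  have lc: "Polynomial.lead_coeff P = to_ac (Polynomial.lead_coeff F)"
    unfolding P_def by (simp add: degree_map_poly coeff_map_poly)
  then have "P \<noteq> 0"
    using assms by auto
  from alg_closed_imp_factorization[OF this] obtain A where
      "P = Polynomial.smult (Polynomial.lead_coeff P) (\<Prod>x\<in>#A. [:-x, 1:])"
    by blast
  then have A: "P = Polynomial.smult (to_ac (Polynomial.lead_coeff F)) (\<Prod>x\<in>#A. [:-x, 1:])"
    by (simp only: lc)
  obtain xs where xs: "mset xs = A"
    using ex_mset by blast
  have fact: "P = Polynomial.smult (to_ac (Polynomial.lead_coeff F)) (\<Prod>x\<leftarrow>xs. [:-x, 1:])"
    by (subst A) (simp add: xs[symmetric] prod_mset_prod_list flip: mset_map)
  then have "poly P x = 0" if "x \<in> set xs" for x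
    using that by (auto simp: poly_prod_linear_factors_eq_0_iff)
  with sub fact show "splits_over K F"
    unfolding splits_over_def P_def by blast
qed

section \<open>Subfields of a field given as a type\<close>

lemma subfield_type_algebraD:
  fixes K :: "'b :: field set"
  assumes "subfield K ring_of_type_algebra"
  shows "x \<in> K \<Longrightarrow> y \<in> K \<Longrightarrow> x * y \<in> K" "x \<in> K \<Longrightarrow> inverse x \<in> K"
proof -
  interpret subfield K "ring_of_type_algebra :: 'b ring" by fact
  show "x \<in> K \<Longrightarrow> y \<in> K \<Longrightarrow> x * y \<in> K"
    using m_closed by (simp add: ring_of_type_algebra_def)
  show "inverse x \<in> K" if "x \<in> K"
  proof (cases "x = 0")
    case False
    with that have "x \<in> K - {\<zero>\<^bsub>ring_of_type_algebra\<^esub>}"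
      by (simp add: ring_of_type_algebra_def)
    then have "x \<in> Units (ring_of_type_algebra \<lparr>carrier := K\<rparr>)"
      by (simp add: subfield_Units)
    then obtain y where "y \<in> K" "x * y = 1"
      by (auto simp: Units_def ring_of_type_algebra_def)
    then show ?thesis
      by (metis inverse_unique)
  qed (use that in simp)
qed

text \<open>Multiplication by a nonzero x permutes the nonzero elements of K; comparing their
  products gives x^(|K| - 1) = 1.\<close>

lemma subfield_power_card_eq_same:
  fixes K :: "'b :: field set"
  assumes K: "subfield K ring_of_type_algebra" and "finite K" and "x \<in> K"
  shows "x ^ card K = x"
proof (cases "x = 0")
  case True
  then show ?thesis
    using assms by (auto simp: power_0_left)
next
  case False
  have "(\<Prod>y\<in>K-{0}. x * y) = (\<Prod>y\<in>K-{0}. y)"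
    by (rule prod.reindex_bij_witness[of _ "\<lambda>y. y * inverse x" "\<lambda>y. x * y"])
      (use False assms subfield_type_algebraD[OF K] in auto)
  then have "x ^ card (K - {0}) * \<Prod>(K-{0}) = \<Prod>(K-{0})"
    by (simp add: prod.distrib)
  moreover have "\<Prod>(K-{0}) \<noteq> 0"
    using \<open>finite K\<close> by simp
  ultimately have "x ^ card (K - {0}) = 1"
    by simp
  moreover have "0 \<in> K"
    using subringE(2)[OF subfieldE(1)[OF K]] by (simp add: ring_of_type_algebra_def)
  ultimately show ?thesis
    using \<open>finite K\<close> by (metis card_Suc_Diff1 mult.right_neutral power_Suc)
qed

lemma subfield_type_algebraI:
  fixes K :: "'b :: field set"
  assumes "1 \<in> K" "\<And>x. x \<in> K \<Longrightarrow> - x \<in> K" "\<And>x. x \<in> K \<Longrightarrow> inverse x \<in> K"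
    and "\<And>x y. x \<in> K \<Longrightarrow> y \<in> K \<Longrightarrow> x * y \<in> K" "\<And>x y. x \<in> K \<Longrightarrow> y \<in> K \<Longrightarrow> x + y \<in> K"
  shows "subfield K ring_of_type_algebra"
proof -
  interpret R: Ring.field "ring_of_type_algebra :: 'b ring" ..
  have minus: "\<ominus>\<^bsub>ring_of_type_algebra\<^esub> x = - x" for x :: 'b
    by (rule R.minus_equality) (simp_all add: ring_of_type_algebra_def)
  have inv: "inv\<^bsub>ring_of_type_algebra\<^esub> x = inverse x" if "x \<noteq> 0" for x :: 'b
    by (rule R.inv_unique'[symmetric]) (use that in \<open>simp_all add: ring_of_type_algebra_def\<close>)
  show ?thesis
  proof (rule R.subfieldI')
    show "subring K ring_of_type_algebra"
      by (rule R.subringI) (use assms in \<open>simp_all add: minus\<close>,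
        use assms in \<open>simp_all add: ring_of_type_algebra_def\<close>)
  next
    fix k assume "k \<in> K - {\<zero>\<^bsub>ring_of_type_algebra :: 'b ring\<^esub>}"
    then have "k \<in> K" "k \<noteq> 0"
      by (simp_all add: ring_of_type_algebra_def)
    then show "inv\<^bsub>ring_of_type_algebra\<^esub> k \<in> K"
      by (simp add: inv assms)
  qed
qed

section \<open>Splitting fields and divisibility\<close>

lemma frobenius_hom_to_ac:
  assumes "CARD('a :: finite_field) = CHAR('a) ^ k"
  shows "frobenius_hom (to_ac :: 'a \<Rightarrow> 'a alg_closure)"
  by (rule frobenius_homI[OF _ assms]) simp_all

text \<open>
  For the converse direction, the remainder of \<open>h\<close> modulo \<open>g\<close> is annihilated by all
  \<open>q ^ degree g\<close> roots of \<open>g\<close>, too many for a nonzero remainder.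
\<close>

lemma lin_eval_roots_subset_iff:
  fixes g h :: "'a :: finite_field poly"
  assumes card: "CARD('a) = CHAR('a) ^ k" and g: "Polynomial.coeff g 0 \<noteq> 0"
  shows "{x. lin_eval to_ac g x = 0} \<subseteq> {x. lin_eval to_ac h x = 0} \<longleftrightarrow> g dvd h"
proof -
  interpret frobenius_hom "to_ac :: 'a \<Rightarrow> 'a alg_closure"
    by (rule frobenius_hom_to_ac[OF card])
  show ?thesis
  proof
    assume "g dvd h"
    then obtain u where "h = u * g"
      by (metis dvdE mult.commute)
    then show "{x. lin_eval to_ac g x = 0} \<subseteq> {x. lin_eval to_ac h x = 0}"
      by (auto simp: lin_eval_mult lin_eval_zero_right)
  next
    assume sub: "{x. lin_eval to_ac g x = 0} \<subseteq> {x. lin_eval to_ac h x = 0}"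
    define r where "r = h mod g"
    have "h = (h div g) * g + r"
      by (simp add: r_def)
    then have "lin_eval to_ac h x = lin_eval to_ac (h div g) (lin_eval to_ac g x) + lin_eval to_ac r x"
      for x :: "'a alg_closure"
      by (metis lin_eval_add lin_eval_mult)
    with sub have r_roots: "{x. lin_eval to_ac g x = 0} \<subseteq> {x. lin_eval to_ac r x = 0}"
      by (auto simp: lin_eval_zero_right)
    have "r = 0"
    proof (rule ccontr)
      assume "r \<noteq> 0"
      define P where "P = map_poly to_ac (linearized_associate r)"
      have deg: "Polynomial.degree P = CARD('a) ^ Polynomial.degree r"
        unfolding P_def
        by (subst degree_map_poly) (simp_all add: linearized_associate_degree_and_nonzero \<open>r \<noteq> 0\<close>)
      then have "P \<noteq> 0"
        by auto
      have "CARD('a) ^ Polynomial.degree g = card {x. lin_eval to_ac g x = 0}"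
        using card_roots_lin_eval[OF g] by simp
      also have "\<dots> \<le> card {x. poly P x = 0}"
        using r_roots poly_roots_finite[OF \<open>P \<noteq> 0\<close>]
        by (intro card_mono) (simp_all add: P_def poly_linearized_associate)
      also have "\<dots> \<le> CARD('a) ^ Polynomial.degree r"
        using card_poly_roots_bound[OF \<open>P \<noteq> 0\<close>] deg by simp
      finally have "Polynomial.degree g \<le> Polynomial.degree r"
        using CARD_field_gt_1[where 'a = 'a] by (simp add: power_increasing_iff)
      moreover have "Polynomial.degree r < Polynomial.degree g"
        using g \<open>r \<noteq> 0\<close> unfolding r_def by (intro degree_mod_less') auto
      ultimately show False by simp
    qed
    then show "g dvd h"
      by (simp add: r_def mod_eq_0_iff_dvd)
  qed
qed

lemma lin_eval_monom_minus_1: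
  fixes x :: "'a :: finite_field alg_closure"
  assumes card: "CARD('a) = CHAR('a) ^ k"
  shows "lin_eval to_ac (Polynomial.monom 1 s - 1) x = x ^ (CARD('a) ^ s) - x"
proof -
  interpret frobenius_hom "to_ac :: 'a \<Rightarrow> 'a alg_closure"
    by (rule frobenius_hom_to_ac[OF card])
  show ?thesis
    by (simp add: lin_eval_diff lin_eval_monom lin_eval_1)
qed

lemma degree_monom_minus_1:
  "Polynomial.degree (Polynomial.monom 1 s - 1 :: 'a :: comm_ring_1 poly) = s"
\<comment> \<open>For s = 0 the polynomial is zero, which has degree 0 by convention.\<close>
proof (cases "s = 0")
  case False
  then show ?thesis
    by (subst diff_conv_add_uminus, subst degree_add_eq_left) (auto simp: degree_monom_eq)
qed (simp add: monom_0 flip: one_pCons)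

text \<open>Existence of the field with q^s elements: K is the root set of the associate of X^s - 1,
  whose constant coefficient is -1, so the roots can be counted. Closure under addition is
  additivity of the Frobenius power.\<close>

lemma fixed_points_frobenius_power:
  assumes card: "CARD('a :: finite_field) = CHAR('a) ^ k" and "s > 0"
  defines "K \<equiv> {x :: 'a alg_closure. x ^ (CARD('a) ^ s) = x}"
  shows "card K = CARD('a) ^ s" "finite K" "subfield K ring_of_type_algebra"
proof -
  have "Polynomial.coeff (Polynomial.monom 1 s - 1 :: 'a poly) 0 \<noteq> 0"
    using \<open>s > 0\<close> by simp
  from card_roots_lin_eval[OF this] show card_K: "card K = CARD('a) ^ s"
    by (simp add: K_def lin_eval_monom_minus_1[OF card] degree_monom_minus_1)
  then show "finite K"
    by (metis card.infinite CARD_field_gt_1 less_numeral_extra(3) not_one_less_zero power_eq_0_iff)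
  have "CARD('a) ^ s = CHAR('a alg_closure) ^ (k * s)"
    by (simp add: card power_mult)
  then have add: "(x + y) ^ (CARD('a) ^ s) = x ^ (CARD('a) ^ s) + y ^ (CARD('a) ^ s)"
    for x y :: "'a alg_closure"
    by (rule freshmans_dream'[rotated]) simp
  \<comment> \<open>Deduced from additivity at x + (-x) = 0, which avoids a case distinction on
    characteristic 2.\<close>
  have uminus: "(- x) ^ (CARD('a) ^ s) = - (x ^ (CARD('a) ^ s))" for x :: "'a alg_closure"
    using add[of x "- x"] \<open>s > 0\<close> by (simp add: power_0_left add_eq_0_iff)
  show "subfield K ring_of_type_algebra"
    by (rule subfield_type_algebraI)
      (simp_all add: K_def add uminus power_mult_distrib power_inverse)
qed

text \<open>Uniqueness: every element of K is a fixed point, and the two finite sets have equal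
  size.\<close>

lemma subfield_eq_fixed_points:
  fixes K :: "'a :: finite_field alg_closure set"
  assumes card: "CARD('a) = CHAR('a) ^ k" and "s > 0"
    and K: "subfield K ring_of_type_algebra" "card K = CARD('a) ^ s"
  shows "K = {x. x ^ (CARD('a) ^ s) = x}"
proof (rule card_subset_eq)
  have "finite K"
    using K(2) by (metis card.infinite CARD_field_gt_1 less_numeral_extra(3) not_one_less_zero power_eq_0_iff)
  with K show "K \<subseteq> {x. x ^ (CARD('a) ^ s) = x}"
    using subfield_power_card_eq_same[OF K(1)] by auto
qed (use fixed_points_frobenius_power[OF card \<open>s > 0\<close>] K in simp_all)

lemma splits_over_degree_linearized_associate_iff:
  fixes g :: "'a :: finite_field poly"
  assumes card: "CARD('a) = CHAR('a) ^ k" and g: "Polynomial.coeff g 0 \<noteq> 0" and "s > 0"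
  shows "splits_over_degree s (linearized_associate g) \<longleftrightarrow> g dvd Polynomial.monom 1 s - 1"
proof -
  have nz: "linearized_associate g \<noteq> 0"
    using g by (intro linearized_associate_degree_and_nonzero) auto
  \<comment> \<open>Existence and uniqueness of the subfield with q^s elements eliminate the
    quantifier over K.\<close>
  have "splits_over_degree s (linearized_associate g) \<longleftrightarrow>
      splits_over {x. x ^ (CARD('a) ^ s) = x} (linearized_associate g)"
    unfolding splits_over_degree_def
    using subfield_eq_fixed_points[OF card \<open>s > 0\<close>] fixed_points_frobenius_power[OF card \<open>s > 0\<close>]
    by metis
  also have "\<dots> \<longleftrightarrow> {x. lin_eval to_ac g x = 0} \<subseteq>
      {x. lin_eval to_ac (Polynomial.monom 1 s - 1) x = 0}"
    by (simp add: splits_over_iff[OF nz] poly_linearized_associate lin_eval_monom_minus_1[OF card])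
  also have "\<dots> \<longleftrightarrow> g dvd Polynomial.monom 1 s - 1"
    by (rule lin_eval_roots_subset_iff[OF card g])
  finally show ?thesis .
qed

section \<open>The squarefree part\<close>

lemma finite_polys_degree_le: "finite {g :: 'a :: {finite, zero} poly. Polynomial.degree g \<le> d}"
proof (rule finite_subset)
  show "finite (Poly ` {xs :: 'a list. set xs \<subseteq> UNIV \<and> length xs \<le> Suc d})"
    by (intro finite_imageI finite_lists_length_le) simp
  show "{g :: 'a poly. Polynomial.degree g \<le> d} \<subseteq>
      Poly ` {xs. set xs \<subseteq> UNIV \<and> length xs \<le> Suc d}"
  proof
    fix g :: "'a poly" assume "g \<in> {g. Polynomial.degree g \<le> d}"
    then have "length (coeffs g) \<le> Suc d"
      by (simp add: length_coeffs coeffs_def)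
    then show "g \<in> Poly ` {xs. set xs \<subseteq> UNIV \<and> length xs \<le> Suc d}"
      by (intro image_eqI[of _ _ "coeffs g"]) simp_all
  qed
qed

text \<open>Since P is prime and does not divide g, the whole power P^i must divide the cofactor of
  g, and it can be cancelled.\<close>

lemma dvd_prime_power_mult_cancel:
  fixes g h :: "'a :: algebraic_semidom"
  assumes "prime_elem P" "\<not> P dvd g" "g dvd P ^ i * h"
  shows "g dvd h"
proof (cases "i = 0")
  case False
  obtain v where v: "P ^ i * h = g * v"
    using assms(3) by blast
  then have "P ^ i dvd g * v"
    by (metis dvd_triv_left)
  then have "P ^ i dvd v"
    by (rule prime_power_dvd_multD[OF assms(1) _ _ assms(2)]) (use False in simp)
  then obtain w where "v = P ^ i * w"
    by blast
  with v have "P ^ i * h = P ^ i * (g * w)"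
    by (simp add: mult_ac)
  moreover have "P \<noteq> 0"
    using assms(1) by (auto simp: prime_elem_def)
  ultimately show ?thesis
    by simp
qed (use assms in simp)

text \<open>Pigeonhole: two powers of X agree modulo g, so g divides X^i (X^(j-i) - 1), and X^i
  cancels.\<close>

lemma poly_ord_exists:
  fixes g :: "'a :: {field, finite} poly"
  assumes "g \<noteq> 0" "\<not> [:0, 1:] dvd g"
  shows "\<exists>i>0. g dvd Polynomial.monom 1 i - 1"
proof -
  define r where "r = (\<lambda>i. (Polynomial.monom 1 i :: 'a poly) mod g)"
  \<comment> \<open>The weak inequality also covers a zero remainder when g is constant.\<close>
  have "Polynomial.degree (p mod g) \<le> Polynomial.degree g" for p
    using degree_mod_less[OF \<open>g \<noteq> 0\<close>, of p] by auto
  then have "range r \<subseteq> {p. Polynomial.degree p \<le> Polynomial.degree g}"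
    by (auto simp: r_def)
  then have "finite (range r)"
    using finite_polys_degree_le finite_subset by blast
  then have "\<not> inj r"
    using finite_imageD infinite_UNIV_nat by blast
  then obtain i j where ij: "r i = r j" "i < j"
    unfolding inj_def by (metis nat_neq_iff)
  then have *: "g dvd Polynomial.monom 1 j - Polynomial.monom 1 i"
    unfolding r_def by (metis mod_eq_dvd_iff)
  have X_pow: "[:0, 1:] ^ i = (Polynomial.monom 1 i :: 'a poly)"
    by (simp add: monom_altdef)
  note *
  also have "Polynomial.monom 1 j - Polynomial.monom 1 i =
      [:0, 1:] ^ i * (Polynomial.monom 1 (j - i) - 1 :: 'a poly)"
    using \<open>i < j\<close> by (simp add: right_diff_distrib mult_monom X_pow)
  finally have "g dvd Polynomial.monom 1 (j - i) - 1"
    by (rule dvd_prime_power_mult_cancel[OF prime_elem_linear_field_poly assms(2), rotated]) simp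
  with \<open>i < j\<close> show ?thesis
    by (intro exI[of _ "j - i"]) simp
qed

section \<open>Divisibility through multiplicities of irreducible factors\<close>

lemma irreducible_factor_exists:
  fixes f :: "'a :: field poly"
  assumes "Polynomial.degree f > 0"
  shows "\<exists>g. irreducible g \<and> g dvd f"
  using assms
proof (induction "Polynomial.degree f" arbitrary: f rule: less_induct)
  case less
  show ?case
  proof (cases "irreducible f")
    case False
    have "f \<noteq> 0"
      using less.prems by auto
    with less.prems have "\<not> is_unit f"
      by (simp add: is_unit_iff_degree)
    with False \<open>f \<noteq> 0\<close> obtain a b where ab: "f = a * b" "\<not> is_unit a" "\<not> is_unit b"
      by (auto simp: irreducible_def)
    then have "a \<noteq> 0" "b \<noteq> 0"
      using less.prems by auto
    with ab have "Polynomial.degree a > 0" "Polynomial.degree a < Polynomial.degree f"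
      by (auto simp: is_unit_iff_degree degree_mult_eq)
    with less.hyps ab(1) show ?thesis
      by (meson dvd_mult2)
  qed auto
qed

text \<open>Induction on the degree: the full power g^k of one irreducible factor is split off. The
  cofactor u divides h by induction, and g^k divides the quotient h/u because g does not divide
  u.\<close>

lemma dvd_if_prime_powers_dvd:
  fixes f h :: "'a :: field poly"
  assumes "f \<noteq> 0" "\<And>g k. irreducible g \<Longrightarrow> g ^ k dvd f \<Longrightarrow> g ^ k dvd h"
  shows "f dvd h"
  using assms
proof (induction "Polynomial.degree f" arbitrary: f rule: less_induct)
  case less
  show ?case
  proof (cases "Polynomial.degree f = 0")
    case True
    with less.prems(1) show ?thesis
      by (simp add: is_unit_iff_degree unit_imp_dvd)
  next
    case False
    then obtain g where g: "irreducible g" "g dvd f"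
      using irreducible_factor_exists by blast
    then have prime: "prime_elem g" and nu: "\<not> is_unit g"
      by (simp_all add: field_poly_irreducible_imp_prime irreducible_not_unit)
    have "g \<noteq> 0"
      using prime by auto
    with nu have deg: "Polynomial.degree g > 0"
      by (simp add: is_unit_iff_degree)
    \<comment> \<open>Comparing degrees bounds the multiplicity of g, so an exact exponent k
      exists.\<close>
    have "\<not> g ^ Suc (Polynomial.degree f) dvd f"
    proof
      assume "g ^ Suc (Polynomial.degree f) dvd f"
      from dvd_imp_degree_le[OF this less.prems(1)]
      have "Suc (Polynomial.degree f) * Polynomial.degree g \<le> Polynomial.degree f"
        using \<open>g \<noteq> 0\<close> by (simp add: degree_power_eq del: power_Suc)
      with deg show False
        by (cases "Polynomial.degree g") auto
    qed
    from ex_least_nat_less[of "\<lambda>n. \<not> g ^ n dvd f", OF this]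
    obtain k where k: "g ^ k dvd f" "\<not> g ^ Suc k dvd f"
      by auto
    then have "k \<ge> 1"
      using g by (cases k) auto
    obtain u where u: "f = g ^ k * u"
      using k(1) by blast
    have "\<not> g dvd u"
      using k(2) u mult_dvd_mono[of g u "g ^ k" "g ^ k"] by (auto simp: mult_ac)
    have "u \<noteq> 0"
      using less.prems(1) u by auto
    then have "Polynomial.degree u < Polynomial.degree f"
      using \<open>k \<ge> 1\<close> \<open>g \<noteq> 0\<close> deg unfolding u by (simp add: degree_mult_eq degree_power_eq)
    then have "u dvd h"
      using less.hyps[of u] less.prems(2) \<open>u \<noteq> 0\<close> u by (metis dvd_mult)
    then obtain v where v: "h = u * v"
      by blast
    have "g ^ k dvd u * v"
      using less.prems(2)[OF g(1), of k] k(1) v by simp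
    then have "g ^ k dvd v"
      by (rule prime_power_dvd_multD[OF prime _ _ \<open>\<not> g dvd u\<close>]) (use \<open>k \<ge> 1\<close> in simp)
    with u v show ?thesis
      by (simp add: mult_dvd_mono mult.commute)
  qed
qed

lemma prime_elem_dvd_prod:
  assumes "prime_elem p" "finite S" "p dvd prod f S"
  shows "\<exists>x\<in>S. p dvd f x"
  using assms(2,3)
proof (induction S)
  case empty
  then show ?case
    using prime_elem_not_unit[OF assms(1)] by simp
next
  case (insert x S)
  then show ?case
    using assms(1) by (auto simp: prime_elem_dvd_mult_iff)
qed

text \<open>The multiplicity of g in h is at most 1, hence at most N in h^N.\<close>

lemma prime_power_dvd_power_squarefree:
  fixes h :: "'a :: algebraic_semidom"
  assumes "prime_elem g" "\<not> g ^ 2 dvd h" "g ^ j dvd h ^ N"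
  shows "j \<le> N"
proof (cases "g dvd h")
  case True
  then obtain u where u: "h = g * u"
    by blast
  with assms(2) have "\<not> g dvd u"
    using mult_dvd_mono[of g g g u] by (auto simp: power2_eq_square)
  show ?thesis
  proof (rule ccontr)
    assume "\<not> j \<le> N"
    then have "g ^ Suc N dvd g ^ N * u ^ N"
      using assms(3) u by (metis not_less_eq_eq power_le_dvd power_mult_distrib)
    moreover have "g ^ N \<noteq> 0"
      using prime_elem_imp_nonzero assms(1) by (auto simp: prime_elem_def)
    ultimately have "g dvd u ^ N"
      by (metis dvd_times_left_cancel_iff power_Suc2)
    with \<open>\<not> g dvd u\<close> assms(1) show False
      using prime_elem_dvd_power by blast
  qed
next
  case False
  then have "\<not> g dvd h ^ N"
    using assms(1) prime_elem_dvd_power by blast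
  with assms(3) have "j = 0"
    by (metis dvd_power dvd_trans not_gr_zero)
  then show ?thesis by simp
qed

text \<open>A square factor would make g divide the derivative m X^(m-1), hence X^m, hence also
  1.\<close>

lemma not_square_dvd_monom_minus_1:
  fixes g :: "'a :: field poly"
  assumes "irreducible g" "of_nat m \<noteq> (0 :: 'a)"
  shows "\<not> g ^ 2 dvd Polynomial.monom 1 m - 1"
proof
  have prime: "prime_elem g"
    using assms by (simp add: field_poly_irreducible_imp_prime)
  assume sq: "g ^ 2 dvd Polynomial.monom 1 m - 1"
  then obtain u where "Polynomial.monom 1 m - 1 = g ^ 2 * u"
    by (rule dvdE)
  then have u: "Polynomial.monom 1 m - 1 = g * (g * u)"
    by (simp only: power2_eq_square mult.assoc)
  have "m > 0"
    using assms(2) by (cases m) auto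
  have "pderiv (Polynomial.monom 1 m - 1) = Polynomial.smult (of_nat m) (Polynomial.monom (1 :: 'a) (m - 1))"
    by (simp add: pderiv_diff pderiv_monom smult_monom)
  moreover have "g dvd pderiv (g * (g * u))"
    by (simp add: pderiv_mult)
  ultimately have "g dvd Polynomial.monom 1 (m - 1)"
    using assms(2) u by (simp add: dvd_smult_iff)
  then have "g dvd Polynomial.monom 1 (m - 1) * Polynomial.monom 1 1"
    by (rule dvd_mult2)
  then have "g dvd Polynomial.monom 1 m"
    using \<open>m > 0\<close> by (simp add: mult_monom)
  moreover have "g dvd Polynomial.monom 1 m - 1"
    by (simp add: u)
  ultimately have "g dvd 1"
    by (metis diff_diff_eq2 add_diff_cancel_left' dvd_diff)
  with prime show False by simp
qed

text \<open>Writing X^m as (X^m - 1) + 1 lets additivity of the Frobenius apply to a sum, with no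
  sign to track.\<close>

lemma monom_minus_1_power:
  assumes "prime CHAR('a :: comm_ring_1)"
  shows "(Polynomial.monom 1 m - 1 :: 'a poly) ^ (CHAR('a) ^ v) = Polynomial.monom 1 (m * CHAR('a) ^ v) - 1"
proof -
  have "Polynomial.monom 1 m ^ (CHAR('a) ^ v) =
      ((Polynomial.monom 1 m - 1) + 1 :: 'a poly) ^ (CHAR('a) ^ v)"
    by simp
  also have "\<dots> = (Polynomial.monom 1 m - 1) ^ (CHAR('a) ^ v) + 1 ^ (CHAR('a) ^ v)"
    by (rule freshmans_dream'[where n = v]) (simp_all add: assms)
  finally show ?thesis
    by (simp add: monom_power mult.commute)
qed

section \<open>Properties of the squarefree part\<close>

context
  fixes f :: "'a :: finite_field poly"
  assumes nz: "f \<noteq> 0"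
begin

text \<open>The degrees are bounded and the field is finite. A product over an infinite set would be
  1 by default, so this gives \<open>poly_squarefree_part\<close> its intended value.\<close>

lemma finite_monic_irreducible_factors:
  "finite {g. irreducible g \<and> Polynomial.lead_coeff g = 1 \<and> g dvd f}"
  by (rule finite_subset[OF _ finite_polys_degree_le[of "Polynomial.degree f"]])
    (use nz in \<open>auto intro: dvd_imp_degree_le\<close>)

text \<open>Dividing g by its leading coefficient yields one of the monic factors in the
  product.\<close>

lemma irreducible_dvd_poly_squarefree_part:
  assumes "irreducible g" "g dvd f"
  shows "g dvd poly_squarefree_part f"
proof -
  define c where "c = inverse (Polynomial.lead_coeff g)"
  have "c \<noteq> 0"
    using assms by (auto simp: c_def irreducible_def)
  then have "is_unit [:c:]"
    by (simp add: is_unit_const_poly_iff dvd_field_iff)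
  then have "irreducible ([:c:] * g)"
    using assms by (subst irreducible_mult_unit_left) auto
  moreover have "Polynomial.lead_coeff (Polynomial.smult c g) = 1"
    using \<open>c \<noteq> 0\<close> by (auto simp: c_def)
  moreover have "Polynomial.smult c g dvd f"
    using assms \<open>c \<noteq> 0\<close> by (simp add: smult_dvd_iff)
  ultimately have "Polynomial.smult c g dvd poly_squarefree_part f"
    unfolding poly_squarefree_part_def
    by (intro dvd_prodI finite_monic_irreducible_factors) simp_all
  then show ?thesis
    using \<open>c \<noteq> 0\<close> by (simp add: smult_dvd_iff)
qed

text \<open>Distinct monic irreducible polynomials do not divide one another, so their product
  divides h once each of them does.\<close>

lemma poly_squarefree_part_dvd_iff:
  "poly_squarefree_part f dvd h \<longleftrightarrow> (\<forall>g. irreducible g \<longrightarrow> g dvd f \<longrightarrow> g dvd h)"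
proof
  assume "poly_squarefree_part f dvd h"
  then show "\<forall>g. irreducible g \<longrightarrow> g dvd f \<longrightarrow> g dvd h"
    using irreducible_dvd_poly_squarefree_part dvd_trans by blast
next
  assume *: "\<forall>g. irreducible g \<longrightarrow> g dvd f \<longrightarrow> g dvd h"
  have "\<Prod>S dvd h" if "finite S" "S \<subseteq> {g. irreducible g \<and> Polynomial.lead_coeff g = 1 \<and> g dvd f}" for S
    using that
  proof (induction S)
    case (insert g S)
    then obtain u where u: "h = \<Prod>S * u"
      by auto
    from insert.prems have g: "prime_elem g" "irreducible g" "Polynomial.lead_coeff g = 1" "g dvd f"
      by (simp_all add: field_poly_irreducible_imp_prime)
    \<comment> \<open>Otherwise g divides some member of S; that member differs from g by a unit,
      which is 1 because both are monic.\<close>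
    have "\<not> g dvd \<Prod>S"
    proof
      assume "g dvd \<Prod>S"
      then obtain g' where g': "g' \<in> S" "g dvd g'"
        using prime_elem_dvd_prod[OF g(1) insert.hyps(1), of id] by auto
      with insert.prems have "irreducible g'" "Polynomial.lead_coeff g' = 1"
        by auto
      moreover obtain u where u: "g' = g * u"
        using g'(2) by blast
      ultimately have "is_unit u"
        using irreducibleD irreducible_not_unit[OF g(2)] by blast
      then obtain c where c: "u = [:c:]"
        by (auto simp: is_unit_poly_iff)
      have "c = 1"
        using \<open>Polynomial.lead_coeff g' = 1\<close> g(3) by (simp add: u c split: if_splits)
      then have "g' = g"
        by (simp add: u c)
      with g'(1) insert.hyps(2) show False by simp
    qed
    moreover have "g dvd \<Prod>S * u"
      using * g u by simp
    ultimately have "g dvd u"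
      using g(1) prime_elem_dvd_mult_iff by blast
    with u insert.hyps show ?case
      by (simp add: mult_dvd_mono mult.commute)
  qed simp
  then show "poly_squarefree_part f dvd h"
    unfolding poly_squarefree_part_def by (simp add: finite_monic_irreducible_factors)
qed

lemma poly_squarefree_part_dvd: "poly_squarefree_part f dvd f"
  by (simp add: poly_squarefree_part_dvd_iff)

lemma poly_squarefree_part_nonzero: "poly_squarefree_part f \<noteq> 0"
  using poly_squarefree_part_dvd nz by auto

text \<open>Multiplicities in f are at most its degree, and the successor keeps the exponent
  positive. Hence the least exponent e exists.\<close>

lemma poly_squarefree_part_exponent:
  "\<exists>m>0. f dvd poly_squarefree_part f ^ m"
proof (intro exI conjI)
  show "f dvd poly_squarefree_part f ^ Suc (Polynomial.degree f)"
  proof (rule dvd_if_prime_powers_dvd[OF nz])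
    fix g k assume g: "irreducible g" "g ^ k dvd f"
    show "g ^ k dvd poly_squarefree_part f ^ Suc (Polynomial.degree f)"
    proof (cases "k = 0")
      case False
      have "g \<noteq> 0" "\<not> is_unit g"
        using g(1) by (auto simp: irreducible_def)
      then have "Polynomial.degree g \<ge> 1"
        by (simp add: is_unit_iff_degree)
      have "k * Polynomial.degree g \<le> Polynomial.degree f"
        using dvd_imp_degree_le[OF g(2) nz] \<open>g \<noteq> 0\<close> by (simp add: degree_power_eq)
      moreover have "k * 1 \<le> k * Polynomial.degree g"
        using \<open>Polynomial.degree g \<ge> 1\<close> by (rule mult_le_mono2)
      ultimately have "k \<le> Suc (Polynomial.degree f)"
        by linarith
      moreover have "g dvd poly_squarefree_part f"
        using irreducible_dvd_poly_squarefree_part[OF g(1)] g(2) False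
      by (metis dvd_power dvd_trans not_gr_zero)
      ultimately show ?thesis
        by (meson dvd_power_le)
    qed simp
  qed
qed simp

text \<open>
  Comparing multiplicities at the irreducible factors of \<open>f\<close>, which are simple factors of
  \<open>h\<close>.
\<close>

lemma dvd_poly_squarefree_part_power_div:
  assumes "f ^ n dvd h ^ N" "n > 0" "\<And>g. irreducible g \<Longrightarrow> \<not> g ^ 2 dvd h"
  shows "f dvd poly_squarefree_part f ^ (N div n)"
proof (rule dvd_if_prime_powers_dvd[OF nz])
  fix g k assume g: "irreducible g" "g ^ k dvd f"
  show "g ^ k dvd poly_squarefree_part f ^ (N div n)"
  proof (cases "k = 0")
    case False
    have "g ^ (k * n) dvd f ^ n"
      using g(2) by (simp add: power_mult dvd_power_same)
    then have "g ^ (k * n) dvd h ^ N"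
      using assms(1) dvd_trans by blast
    then have "k * n \<le> N"
      by (rule prime_power_dvd_power_squarefree[OF
          field_poly_irreducible_imp_prime[OF g(1)] assms(3)[OF g(1)]])
    then have "k \<le> N div n"
      using \<open>n > 0\<close> by (simp add: less_eq_div_iff_mult_less_eq)
    moreover have "g dvd poly_squarefree_part f"
      using irreducible_dvd_poly_squarefree_part[OF g(1)] g(2) False
      by (metis dvd_power dvd_trans not_gr_zero)
    ultimately show ?thesis
      by (meson dvd_power_le)
  qed simp
qed

end

section \<open>Splitting degrees\<close>

text \<open>As q = 0 in the field, the characteristic is a prime dividing p^k.\<close>

lemma CHAR_eqI_CARD_prime_power:
  assumes "prime p" "CARD('a :: finite_field) = p ^ k"
  shows "CHAR('a) = p"
proof -
  have "CHAR('a) dvd p ^ k"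
    using of_nat_CARD_eq_0[where 'a = 'a] assms(2) of_nat_eq_0_iff_char_dvd by metis
  then have "CHAR('a) dvd p"
    using prime_dvd_power[of "CHAR('a)"] by simp
  with assms(1) show ?thesis
    by (simp add: primes_dvd_imp_eq)
qed

text \<open>Characterizes the rounded logarithm as the least v with m <= p^v, so that no real
  logarithm appears in the divisibility argument.\<close>

lemma nat_ceiling_log_le_iff:
  assumes "p \<ge> 2" "m > 0"
  shows "nat \<lceil>log (real p) (real m)\<rceil> \<le> v \<longleftrightarrow> m \<le> p ^ v"
proof -
  have "nat \<lceil>log (real p) (real m)\<rceil> \<le> v \<longleftrightarrow> log (real p) (real m) \<le> real v"
    by (simp add: nat_le_iff ceiling_le_iff)
  also have "\<dots> \<longleftrightarrow> real m \<le> real p powr real v"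
    using assms by (simp add: log_le_iff)
  also have "\<dots> \<longleftrightarrow> m \<le> p ^ v"
    using assms by (simp add: powr_realpow flip: of_nat_power)
  finally show ?thesis .
qed

context
  fixes f f0 :: "'a :: finite_field poly" and e E :: nat
  assumes deg: "Polynomial.degree f > 0" and X: "\<not> [:0, 1:] dvd f"
  defines "f0 \<equiv> poly_squarefree_part f"
    and "e \<equiv> (LEAST m. 0 < m \<and> f dvd f0 ^ m)"
    and "E \<equiv> poly_ord f0"
begin

lemma f_nonzero: "f \<noteq> 0"
  using deg by auto

lemma squarefree_exponent: "e > 0" "f dvd f0 ^ e"
proof -
  have "0 < e \<and> f dvd f0 ^ e"
    unfolding e_def f0_def by (rule LeastI_ex) (rule poly_squarefree_part_exponent[OF f_nonzero])
  then show "e > 0" "f dvd f0 ^ e" by auto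
qed

lemma squarefree_part_order: "E > 0" "f0 dvd Polynomial.monom 1 E - 1"
proof -
  have "\<exists>i>0. f0 dvd Polynomial.monom 1 i - 1"
    using poly_squarefree_part_nonzero[OF f_nonzero] poly_squarefree_part_dvd[OF f_nonzero] X
    unfolding f0_def by (intro poly_ord_exists) (auto dest: dvd_trans)
  then have "0 < E \<and> f0 dvd Polynomial.monom 1 E - 1"
    unfolding E_def poly_ord_def by (rule LeastI_ex)
  then show "E > 0" "f0 dvd Polynomial.monom 1 E - 1" by auto
qed

text \<open>The upper bound: E p^t is an admissible splitting degree as soon as n e <= p^t.\<close>

lemma power_dvd_monom_minus_1:
  assumes "n * e \<le> CHAR('a) ^ t"
  shows "f ^ n dvd Polynomial.monom 1 (E * CHAR('a) ^ t) - 1"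
proof -
  have "f ^ n dvd f0 ^ (e * n)"
    using squarefree_exponent(2) by (simp add: power_mult dvd_power_same)
  also have "\<dots> dvd f0 ^ (CHAR('a) ^ t)"
    using assms by (simp add: le_imp_power_dvd mult.commute)
  also have "\<dots> dvd (Polynomial.monom 1 E - 1) ^ (CHAR('a) ^ t)"
    using squarefree_part_order(2) by (rule dvd_power_same)
  finally show ?thesis
    by (simp add: monom_minus_1_power)
qed

text \<open>The lower bound: p^v is the exact power of p in s. Multiplicities bound e, while the
  primes dividing f must divide X^m - 1, which bounds E.\<close>

lemma power_dvd_monom_minus_1D:
  assumes "f ^ n dvd Polynomial.monom 1 s - 1" "n > 0" "s > 0"
  obtains m v where "s = m * CHAR('a) ^ v" "E \<le> m" "n * e \<le> CHAR('a) ^ v"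
proof -
  define v where "v = multiplicity CHAR('a) s"
  obtain m where m: "s = CHAR('a) ^ v * m" "\<not> CHAR('a) dvd m"
    unfolding v_def
    by (rule multiplicity_decompose'[of s "CHAR('a)"]) (use \<open>s > 0\<close> in \<open>auto dest: not_prime_unit\<close>)
  have "of_nat m \<noteq> (0 :: 'a)"
    using m(2) by (simp add: of_nat_eq_0_iff_char_dvd)
  then have sqf: "\<not> g ^ 2 dvd Polynomial.monom 1 m - 1" if "irreducible g" for g :: "'a poly"
    using that by (rule not_square_dvd_monom_minus_1[rotated])
  have dvd: "f ^ n dvd (Polynomial.monom 1 m - 1) ^ (CHAR('a) ^ v)"
    using assms(1) by (simp add: monom_minus_1_power m(1) mult.commute)
  have "f dvd f0 ^ (CHAR('a) ^ v div n)"
    unfolding f0_def using f_nonzero dvd \<open>n > 0\<close> sqf by (rule dvd_poly_squarefree_part_power_div)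
  \<comment> \<open>A zero exponent would make the nonconstant f divide 1. Positivity is required by
    the definition of e as a least positive exponent.\<close>
  moreover from this have "CHAR('a) ^ v div n > 0"
    using deg f_nonzero by (intro gr0I) (simp add: is_unit_iff_degree)
  ultimately have "e \<le> CHAR('a) ^ v div n"
    unfolding e_def by (intro Least_le) simp
  then have "n * e \<le> CHAR('a) ^ v"
    using \<open>n > 0\<close> by (simp add: less_eq_div_iff_mult_less_eq mult.commute)
  moreover have "f0 dvd Polynomial.monom 1 m - 1"
    unfolding f0_def poly_squarefree_part_dvd_iff[OF f_nonzero]
  proof (intro allI impI)
    fix g assume g: "irreducible g" "g dvd f"
    have "g dvd (Polynomial.monom 1 m - 1) ^ (CHAR('a) ^ v)"
      using g(2) dvd \<open>n > 0\<close> by (meson dvd_power dvd_trans)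
    then show "g dvd Polynomial.monom 1 m - 1"
      using field_poly_irreducible_imp_prime[OF g(1)] prime_elem_dvd_power by blast
  qed
  then have "E \<le> m"
    unfolding E_def poly_ord_def using \<open>s > 0\<close> m(1) by (intro Least_le) simp
  ultimately show ?thesis
    using that m(1) by (simp add: mult.commute)
qed

lemma split_degree_linearized_associate:
  assumes card: "CARD('a) = CHAR('a) ^ k" and "n > 0"
  shows "split_degree (linearized_associate f) n =
      E * CHAR('a) ^ nat \<lceil>log (real CHAR('a)) (real (n * e))\<rceil>"
proof -
  define t where "t = nat \<lceil>log (real CHAR('a)) (real (n * e))\<rceil>"
  have p: "CHAR('a) \<ge> 2"
    by (simp add: prime_ge_2_nat)
  have t_le: "t \<le> v \<longleftrightarrow> n * e \<le> CHAR('a) ^ v" for v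
    unfolding t_def using p \<open>n > 0\<close> squarefree_exponent(1) by (intro nat_ceiling_log_le_iff) simp_all
  have "Polynomial.coeff (f ^ n) 0 \<noteq> 0"
    using X by (simp add: coeff_0_power dvd_iff_poly_eq_0 poly_0_coeff_0)
  then have iff: "splits_over_degree s (poly_iterate (linearized_associate f) n) \<longleftrightarrow>
      f ^ n dvd Polynomial.monom 1 s - 1" if "s > 0" for s
    using that by (simp add: poly_iterate_linearized_associate[OF card]
        splits_over_degree_linearized_associate_iff[OF card])
  show ?thesis
    unfolding split_degree_def t_def[symmetric]
  proof (rule Least_equality)
    have "E * CHAR('a) ^ t > 0"
      using squarefree_part_order(1) by simp
    then show "0 < E * CHAR('a) ^ t \<and>
        splits_over_degree (E * CHAR('a) ^ t) (poly_iterate (linearized_associate f) n)"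
      using power_dvd_monom_minus_1[of n t] t_le[of t] iff by simp
  next
    fix s assume "0 < s \<and> splits_over_degree s (poly_iterate (linearized_associate f) n)"
    then have "0 < s" "f ^ n dvd Polynomial.monom 1 s - 1"
      using iff by auto
    then obtain m v where "s = m * CHAR('a) ^ v" "E \<le> m" "n * e \<le> CHAR('a) ^ v"
      using power_dvd_monom_minus_1D \<open>n > 0\<close> by metis
    \<comment> \<open>Both factors of s = m p^v are bounded below: E <= m, and t <= v by
      \<open>t_le\<close>.\<close>
    then show "E * CHAR('a) ^ t \<le> s"
      using t_le[of v] p by (simp add: mult_le_mono power_increasing)
  qed
qed

end

section \<open>The least limit point of the quotients\<close>

text \<open>With N = \<open>Suc n\<close>, the power p^t is at least N e, so every term is at least
  E e. Along N = p^(k+e) div e the excess is at most E e / N, which tends to 0.\<close>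

lemma ceiling_power_ratio_limit_points:
  fixes p e E :: nat and a :: "nat \<Rightarrow> real"
  assumes "p \<ge> 2" "e > 0"
    and a: "\<And>n. a n = real (E * p ^ nat \<lceil>log (real p) (real (Suc n * e))\<rceil>) / real (Suc n)"
  shows "l \<in> seq_limit_points a \<Longrightarrow> real (E * e) \<le> l"
    and "real (E * e) \<in> seq_limit_points a"
proof -
  define t where "t = (\<lambda>m. nat \<lceil>log (real p) (real m)\<rceil>)"
  have t_le: "t (Suc n * e) \<le> v \<longleftrightarrow> Suc n * e \<le> p ^ v" for n v
    unfolding t_def using assms(1,2) by (intro nat_ceiling_log_le_iff) simp_all
  have a_t: "a n = real (E * p ^ t (Suc n * e)) / real (Suc n)" for n
    by (simp only: a t_def)
  have lower: "real (E * e) \<le> a n" for n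
  proof -
    have "E * (Suc n * e) \<le> E * p ^ t (Suc n * e)"
      using t_le[of n "t (Suc n * e)"] by (intro mult_le_mono2) blast
    then have "E * e * Suc n \<le> E * p ^ t (Suc n * e)"
      by (metis mult.assoc mult.commute)
    then have "real (E * e) * real (Suc n) \<le> real (E * p ^ t (Suc n * e))"
      by (metis of_nat_le_iff of_nat_mult)
    then show ?thesis
      unfolding a_t by (simp add: pos_le_divide_eq)
  qed
  show "real (E * e) \<le> l" if "l \<in> seq_limit_points a"
    using that lower unfolding seq_limit_points_def by (auto intro: LIMSEQ_le_const)
  \<comment> \<open>The shift by e makes p^(k+e) exceed e, so the quotient is positive; 1 is
    subtracted because index n stands for \<open>Suc n\<close>.\<close>
  define r where "r = (\<lambda>k. p ^ (k + e) div e - 1)"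
  have Suc_r: "Suc (r k) = p ^ (k + e) div e" for k
  proof -
    have "e < p ^ e"
      using assms(1) by (intro power_gt_expt) simp
    also have "\<dots> \<le> p ^ (k + e)"
      using assms(1) by (intro power_increasing) simp_all
    finally have "p ^ (k + e) div e > 0"
      using assms(2) by (simp add: div_greater_zero_iff)
    then show ?thesis
      by (simp add: r_def)
  qed
  have "r k < r (Suc k)" for k
  proof -
    have "Suc (r k) < 2 * Suc (r k)"
      by simp
    also have "\<dots> \<le> p * Suc (r k)"
      using assms(1) by (rule mult_le_mono1)
    \<comment> \<open>Multiplying after rounding down gives at most the result of multiplying
      before.\<close>
    also have "\<dots> \<le> p * p ^ (k + e) div e"
      unfolding Suc_r by (subst div_mult1_eq) (rule le_add1)
    also have "\<dots> = Suc (r (Suc k))"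
      unfolding Suc_r by simp
    finally show ?thesis by simp
  qed
  then have mono: "strict_mono r"
    by (simp add: strict_mono_Suc_iff)
  have upper: "a (r k) \<le> real (E * e) + real (E * e) / real (Suc k)" for k
  proof -
    have "Suc (r k) * e \<le> p ^ (k + e)"
      by (simp add: Suc_r del: mult_Suc)
    then have "t (Suc (r k) * e) \<le> k + e"
      using t_le by blast
    then have "p ^ t (Suc (r k) * e) \<le> p ^ (k + e)"
      using assms(1) by (intro power_increasing) simp_all
    \<comment> \<open>The remainder modulo e is less than e.\<close>
    also have "\<dots> \<le> e * Suc (r k) + e"
      unfolding Suc_r using assms(2) by (metis add_left_mono less_imp_le mod_less_divisor mult_div_mod_eq)
    finally have "E * p ^ t (Suc (r k) * e) \<le> E * (e * Suc (r k) + e)"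
      by simp
    then have "real (E * p ^ t (Suc (r k) * e)) \<le> real (E * e) * real (Suc (r k)) + real (E * e)"
      by (metis distrib_left mult.assoc of_nat_add of_nat_le_iff of_nat_mult)
    then have "a (r k) \<le> (real (E * e) * real (Suc (r k)) + real (E * e)) / real (Suc (r k))"
      unfolding a_t by (intro divide_right_mono) simp_all
    also have "\<dots> = real (E * e) + real (E * e) / real (Suc (r k))"
      by (simp add: add_divide_distrib)
    \<comment> \<open>A strictly increasing sequence of naturals satisfies k <= r k.\<close>
    also have "\<dots> \<le> real (E * e) + real (E * e) / real (Suc k)"
      using seq_suble[OF mono, of k] by (intro add_left_mono divide_left_mono) simp_all
    finally show ?thesis .
  qed
  have "(\<lambda>k. real (E * e) + real (E * e) / real (Suc k)) \<longlonglongrightarrow> real (E * e) + 0"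
    by (intro tendsto_add tendsto_const LIMSEQ_Suc lim_const_over_n)
  then have "(a \<circ> r) \<longlonglongrightarrow> real (E * e)"
    by (intro tendsto_sandwich[OF _ _ tendsto_const, of "real (E * e)" "a \<circ> r"])
      (use lower upper in \<open>auto intro!: always_eventually\<close>)
  with mono show "real (E * e) \<in> seq_limit_points a"
    unfolding seq_limit_points_def by blast
qed

theorem theorem4p1:
  fixes p q e E :: nat and f f0 A :: "'a :: finite_field poly"
  assumes "prime p"
    and "\<exists>k>0. q = p ^ k"
    and "CARD('a) = q"
    and "Polynomial.degree f > 0"
    and "\<not> [:0, 1:] dvd f"
    and "f0 = poly_squarefree_part f"
    and "e = (LEAST m. 0 < m \<and> f dvd f0 ^ m)"
    and "E = poly_ord f0"
    and "A = linearized_associate f"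
  shows "(\<forall>n\<ge>1. split_degree A n = E * p ^ nat \<lceil>log (real p) (real (n * e))\<rceil>) \<and>
         (\<forall>c>0. seq_limit_points (\<lambda>n. real (split_degree A (Suc n)) / real (Suc n)) = {c..real p * c}
            \<longrightarrow> c = real (E * e))"
proof (intro conjI allI impI)
  obtain k where k: "CARD('a) = p ^ k"
    using assms(2,3) by blast
  have p: "CHAR('a) = p"
    using assms(1) k by (rule CHAR_eqI_CARD_prime_power)
  have card: "CARD('a) = CHAR('a) ^ k"
    by (simp add: k p)
  have formula: "split_degree A n = E * p ^ nat \<lceil>log (real p) (real (n * e))\<rceil>" if "n \<ge> 1" for n
    using split_degree_linearized_associate[OF assms(4,5) card, of n] that assms(6-9) by (simp add: p)
  then show "split_degree A n = E * p ^ nat \<lceil>log (real p) (real (n * e))\<rceil>" if "n \<ge> 1" for n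
    using that .
  fix c :: real
  let ?a = "\<lambda>n. real (split_degree A (Suc n)) / real (Suc n)"
  assume c: "c > 0" and points: "seq_limit_points ?a = {c..real p * c}"
  have "p \<ge> 2"
    using assms(1) by (simp add: prime_ge_2_nat)
  have "e > 0"
    using squarefree_exponent(1)[OF assms(4,5)] assms(6,7) by simp
  have a: "?a n = real (E * p ^ nat \<lceil>log (real p) (real (Suc n * e))\<rceil>) / real (Suc n)" for n
    by (subst formula) simp_all
  note limit_points = ceiling_power_ratio_limit_points[OF \<open>p \<ge> 2\<close> \<open>e > 0\<close> a]
  \<comment> \<open>Both c and E e turn out to be the least limit point: c is the left endpoint of
    the interval, and belongs to it because c <= p c.\<close>
  have "c \<in> seq_limit_points ?a"
    unfolding points using c \<open>p \<ge> 2\<close> by simp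
  with limit_points(1) have "real (E * e) \<le> c" .
  moreover have "c \<le> real (E * e)"
    using limit_points(2) unfolding points by simp
  ultimately show "c = real (E * e)"
    by simp
qed

end
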